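(* Let $r\in\mathbb{N}$, let $\omega:\mathbb{R}\to\mathbb{R}$ be a weighting function with $\omega(0)=0$, let $\sigma>0$, let $B\subset\mathbb{R}^2$ be a square and let $n\in\mathbb{N}$ be a discretization step. If $\omega$ is $C^r$ over $\mathbb{R}$, then the persistence image $V_{B,n}:Bar_0\to\mathbb{R}^{n^2}$ is $r$-differentiable everywhere in $Bar_0$.
   Context: Barcodes: a barcode is a multiset $D=D'\cup\Delta^\infty$, where $D'$ is a finite multiset of elements of $\mathbb{R}\times(\mathbb{R}\cup\{+\infty\})$ and $\Delta^\infty$ consists of the diagonal $\Delta=\{(b,b)\mid b\in\mathbb{R}\}$ with countably infinite multiplicity. $Bar_0$ is the set of barcodes with no infinite interval (no point with second coordinate $+\infty$). For $m\in\mathbb{N}$, $Q_{m,0}:\mathbb{R}^{2m}\to Bar_0$ is $Q_{m,0}(b_1,d_1,\dots,b_m,d_m)=\{(b_i,d_i)\}_{i=1}^m\cup\Delta^\infty$. A map $V:Bar_0\to\mathbb{R}^k$ is $r$-differentiable at $D\in Bar_0$ if for all $m\in\mathbb{N}$ and all $\tilde D\in\mathbb{R}^{2m}$ with $Q_{m,0}(\tilde D)=D$, the map $V\circ Q_{m,0}$ is $C^r$ on an open neighborhood of $\tilde D$. Persistence image: for $(b,d)\in\mathbb{R}^2$ let $g_{b,d}(x,y)=\frac{1}{2\pi\sigma^2}e^{-[(x-b)^2+(y-(d-b))^2]/2\sigma^2}$. For $D\in Bar_0$ let $\rho_D(x,y)=\sum_{(b,d)\in D}\omega(d-b)g_{b,d}(x,y)$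 (diagonal points contribute $0$ since $\omega(0)=0$). The square $B$ is subdivided into $n^2$ regular squares $B_{k,l}$, $1\le k,l\le n$, and $V_{B,n}(D)=\left(\int_{B_{k,l}}\rho_D(x,y)\,dx\,dy\right)_{1\le k,l\le n}\in\mathbb{R}^{n^2}$. *)

theory Defs
  imports "HOL-Analysis.Analysis"
begin

section \<open>Barcodes\<close>

text \<open>A multiset that may contain points infinitely often is represented by its multiplicity
  function. Points live in \<open>\<real> \<times> (\<real> \<union> {+\<infinity>})\<close>; the second coordinate is an extended real that is
  required to differ from \<open>-\<infinity>\<close>.\<close>

type_synonym barcode = "real \<times> ereal \<Rightarrow> enat"

definition diagonal_inf :: barcode where
  "diagonal_inf = (\<lambda>(b, d). if d = ereal b then \<infinity> else 0)"

definition barcode_of :: "(real \<times> ereal) multiset \<Rightarrow> barcode" where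
  "barcode_of D' = (\<lambda>p. enat (count D' p) + diagonal_inf p)"

definition Bar :: "barcode set" where
  "Bar = {barcode_of D' | D'. \<forall>(b, d) \<in># D'. d \<noteq> -\<infinity>}"

definition Bar0 :: "barcode set" where
  "Bar0 = {D \<in> Bar. \<forall>b. D (b, \<infinity>) = 0}"

text \<open>A vector \<open>(b\<^sub>1, d\<^sub>1, \<dots>, b\<^sub>m, d\<^sub>m)\<close> of \<open>\<real>\<^sup>2\<^sup>m\<close> is an element \<open>x\<close> of
  \<^term>\<open>topspace (Euclidean_space (2 * m))\<close>; coordinates are counted from \<open>0\<close>, so
  \<open>b\<^sub>i = x (2 * (i - 1))\<close> and \<open>d\<^sub>i = x (2 * (i - 1) + 1)\<close>.\<close>

definition Q0 :: "nat \<Rightarrow> (nat \<Rightarrow> real) \<Rightarrow> barcode" where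
  "Q0 m x = barcode_of {# (x (2 * i), ereal (x (2 * i + 1))). i \<in># mset_set {..<m} #}"

section \<open>Maps of class \<open>C\<^sup>r\<close>\<close>

text \<open>\<open>C\<^sup>r\<close> on an open subset \<open>U\<close> of \<open>\<real>\<^sup>N\<close> means that all iterated partial derivatives of order
  at most \<open>r\<close> exist and are continuous on \<open>U\<close>.\<close>

primrec Cr_on :: "nat \<Rightarrow> nat \<Rightarrow> (nat \<Rightarrow> real) set \<Rightarrow> ((nat \<Rightarrow> real) \<Rightarrow> real) \<Rightarrow> bool" where
  "Cr_on 0 N U f \<longleftrightarrow>
     continuous_map (subtopology (Euclidean_space N) U) euclideanreal f"
| "Cr_on (Suc r) N U f \<longleftrightarrow>
     continuous_map (subtopology (Euclidean_space N) U) euclideanreal f \<and>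
     (\<forall>i<N. \<exists>g. (\<forall>x\<in>U. ((\<lambda>t. f (x(i := t))) has_real_derivative g x) (at (x i))) \<and>
                Cr_on r N U g)"

definition Cr_map_on ::
  "nat \<Rightarrow> nat \<Rightarrow> nat \<Rightarrow> (nat \<Rightarrow> real) set \<Rightarrow> ((nat \<Rightarrow> real) \<Rightarrow> (nat \<Rightarrow> real)) \<Rightarrow> bool" where
  "Cr_map_on r N k U F \<longleftrightarrow>
     F \<in> U \<rightarrow> topspace (Euclidean_space k) \<and> (\<forall>j<k. Cr_on r N U (\<lambda>x. F x j))"

definition Cr_real :: "nat \<Rightarrow> (real \<Rightarrow> real) \<Rightarrow> bool" where
  "Cr_real r f \<longleftrightarrow>
     (\<forall>j<r. \<forall>x. (deriv ^^ j) f field_differentiable at x) \<and> continuous_on UNIV ((deriv ^^ r) f)"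

text \<open>In \<open>r_differentiable_at r k V D\<close> the map \<open>V\<close> goes from \<^term>\<open>Bar0\<close> to \<open>\<real>\<^sup>k\<close>.\<close>

definition r_differentiable_at ::
  "nat \<Rightarrow> nat \<Rightarrow> (barcode \<Rightarrow> (nat \<Rightarrow> real)) \<Rightarrow> barcode \<Rightarrow> bool" where
  "r_differentiable_at r k V D \<longleftrightarrow>
     (\<forall>m. \<forall>x \<in> topspace (Euclidean_space (2 * m)). Q0 m x = D \<longrightarrow>
        (\<exists>U. openin (Euclidean_space (2 * m)) U \<and> x \<in> U \<and>
             Cr_map_on r (2 * m) k U (V \<circ> Q0 m)))"

section \<open>Persistence images\<close>

definition gauss :: "real \<Rightarrow> real \<Rightarrow> real \<Rightarrow> real \<times> real \<Rightarrow> real" where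
  "gauss \<sigma> b d = (\<lambda>(x, y).
     1 / (2 * pi * \<sigma>\<^sup>2) * exp (- ((x - b)\<^sup>2 + (y - (d - b))\<^sup>2) / (2 * \<sigma>\<^sup>2)))"

text \<open>The sum over the points of \<open>D\<close> counted with multiplicity ranges over all pairs \<open>(p, j)\<close> with
  \<open>j\<close> smaller than the multiplicity of \<open>p\<close>. If \<open>\<omega> 0 = 0\<close> and \<open>D\<close> is a barcode, only finitely many
  summands are nonzero. The conversion \<^const>\<open>real_of_ereal\<close> is only meaningful for finite second
  coordinates, i.e. for \<open>D\<close> in \<^term>\<open>Bar0\<close>.\<close>

definition persistence_surface ::
  "(real \<Rightarrow> real) \<Rightarrow> real \<Rightarrow> barcode \<Rightarrow> real \<times> real \<Rightarrow> real" where
  "persistence_surface \<omega> \<sigma> D z =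
     (\<Sum>\<^sub>\<infinity>((b, d), j) \<in> (SIGMA p:UNIV. {j. enat j < D p}).
        \<omega> (real_of_ereal d - b) * gauss \<sigma> b (real_of_ereal d) z)"

text \<open>\<open>B\<close> is a square with corner \<open>p\<close> and sides \<open>u\<close>, \<open>v\<close>. It need not be parallel to the axes.\<close>

definition is_square ::
  "(real \<times> real) set \<Rightarrow> real \<times> real \<Rightarrow> real \<times> real \<Rightarrow> real \<times> real \<Rightarrow> bool" where
  "is_square B p u v \<longleftrightarrow>
     u \<noteq> 0 \<and> norm u = norm v \<and> u \<bullet> v = 0 \<and>
     B = {p + s *\<^sub>R u + t *\<^sub>R v | s t. s \<in> {0..1} \<and> t \<in> {0..1}}"

text \<open>The square \<open>B\<^sub>k\<^sub>,\<^sub>l\<close> of the regular subdivision, for \<open>1 \<le> k, l \<le> n\<close>.\<close>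

definition subsquare ::
  "real \<times> real \<Rightarrow> real \<times> real \<Rightarrow> real \<times> real \<Rightarrow> nat \<Rightarrow> nat \<Rightarrow> nat \<Rightarrow> (real \<times> real) set" where
  "subsquare p u v n k l =
     {p + s *\<^sub>R u + t *\<^sub>R v | s t.
        s \<in> {(real k - 1) / real n .. real k / real n} \<and>
        t \<in> {(real l - 1) / real n .. real l / real n}}"

text \<open>The entries indexed by \<open>(k, l)\<close> are listed in row-major order to give a vector of \<open>\<real>\<close> to the
  power \<open>n\<^sup>2\<close>: position \<open>i < n\<^sup>2\<close> belongs to \<open>k = i div n + 1\<close>, \<open>l = i mod n + 1\<close>.\<close>

definition persistence_image ::
  "(real \<Rightarrow> real) \<Rightarrow> real \<Rightarrow> real \<times> real \<Rightarrow> real \<times> real \<Rightarrow> real \<times> real \<Rightarrow> nat \<Rightarrow>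
   barcode \<Rightarrow> (nat \<Rightarrow> real)" where
  "persistence_image \<omega> \<sigma> p u v n D =
     (\<lambda>i. if i < n\<^sup>2
          then LINT z : subsquare p u v n (i div n + 1) (i mod n + 1) | lborel.
                 persistence_surface \<omega> \<sigma> D z
          else 0)"

end

theory Submission
  imports Defs
begin

text \<open>
  On a lift \<open>(b\<^sub>1, d\<^sub>1, \<dots>, b\<^sub>m, d\<^sub>m)\<close> of a barcode the diagonal contributes nothing, because
  \<open>\<omega> 0 = 0\<close>, and integration over a subsquare \<open>S\<close> commutes with the remaining finite sum. Hence
  each coordinate of the persistence image is, on the whole of \<open>\<real>\<^sup>2\<^sup>m\<close>,
  the sum over \<open>i\<close> of \<open>\<omega> (d\<^sub>i - b\<^sub>i)\<close> times the integral of the Gaussian of \<open>(b\<^sub>i, d\<^sub>i)\<close> over \<open>S\<close>.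
  The first factor is a \<open>C\<^sup>r\<close> function composed with a linear one, so the point is that the second
  factor is smooth in \<open>(b, d)\<close>. This is differentiation under the integral sign over a compact set
  (lemma \<open>has_real_derivative_set_integral\<close>), but it has to be iterated. The functions that arise
  are all integrals over \<open>S\<close> of the Gaussian against monomials in \<open>x - b\<close> and \<open>y - (d - b)\<close>, and
  a first partial derivative of such an integral is a linear combination of integrals of the same
  form. One induction on the order, carried out for all of them simultaneously
  (lemma \<open>Cr_on_gauss_moment\<close>), therefore gives smoothness.
\<close>

section \<open>Integrals over a compact set that depend on a parameter\<close>

lemma set_integrable_compact:
  fixes f :: "'a::euclidean_space \<Rightarrow> real"
  assumes "compact S" "continuous_on S f"
  shows "set_integrable lborel S f"
  using borel_integrable_compact[OF assms] by (simp add: set_integrable_def)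

lemma abs_set_integral_compact_le:
  fixes f :: "'a::euclidean_space \<Rightarrow> real"
  assumes "compact S" "continuous_on S f" "\<And>z. z \<in> S \<Longrightarrow> \<bar>f z\<bar> \<le> e"
  shows "\<bar>LINT z:S|lborel. f z\<bar> \<le> measure lborel S * e"
proof -
  have "\<bar>LINT z:S|lborel. f z\<bar> \<le> (LINT z:S|lborel. \<bar>f z\<bar>)"
    using set_integral_norm_bound[OF set_integrable_compact[OF assms(1,2)]] by simp
  also have "\<dots> \<le> (LINT z:S|lborel. e)"
    by (intro set_integral_mono set_integrable_compact continuous_intros assms)
  also have "\<dots> = measure lborel S * e"
    using fmeasurable_compact[OF assms(1)]
    by (subst set_integral_const) (auto simp: fmeasurable_def)
  finally show ?thesis .
qed

lemma continuous_on_set_integral_compact: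
  fixes k :: "'p::metric_space \<Rightarrow> 'a::euclidean_space \<Rightarrow> real"
  assumes S: "compact S" and k: "continuous_on UNIV (\<lambda>(t, z). k t z)"
  shows "continuous_on UNIV (\<lambda>t. LINT z:S|lborel. k t z)"
proof -
  have kt: "continuous_on S (k t)" for t
    using continuous_on_compose2[OF k continuous_on_Pair[OF continuous_on_const continuous_on_id],
        of t S] by simp
  have "isCont (\<lambda>t. LINT z:S|lborel. k t z) t0" for t0
    unfolding continuous_at_eps_delta
  proof (intro allI impI)
    fix e :: real assume e: "e > 0"
    \<comment> \<open>The summand \<open>1\<close> keeps the quotient meaningful when \<open>S\<close> is a null set.\<close>
    define c where "c = e / (measure lborel S + 1)"
    have "measure lborel S + 1 > 0" by (rule add_nonneg_pos) auto
    then have c: "c > 0" "measure lborel S * c < e"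
      using e by (auto simp: c_def divide_simps algebra_simps)
    have "continuous_on (UNIV \<times> S) (\<lambda>(t, z). k t z)"
      using k by (rule continuous_on_subset) auto
    then obtain X where X: "t0 \<in> X" "open X"
      "\<forall>t\<in>X \<inter> UNIV. \<forall>z\<in>S. dist (case (t, z) of (t, z) \<Rightarrow> k t z)
        (case (t0, z) of (t, z) \<Rightarrow> k t z) \<le> c"
      by (rule continuous_on_prod_compactE[OF _ S UNIV_I c(1)])
    from X(1,2) obtain d where d: "d > 0" "ball t0 d \<subseteq> X" by (auto simp: open_contains_ball)
    have "dist (LINT z:S|lborel. k t z) (LINT z:S|lborel. k t0 z) < e" if "dist t t0 < d" for t
    proof -
      have "t \<in> X" using that d by (auto simp: dist_commute)
      then have "\<bar>k t z - k t0 z\<bar> \<le> c" if "z \<in> S" for z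
        using X(3) that by (auto simp: dist_real_def)
      then have "\<bar>LINT z:S|lborel. k t z - k t0 z\<bar> \<le> measure lborel S * c"
        by (intro abs_set_integral_compact_le S continuous_on_diff kt)
      then show ?thesis
        using c(2) by (simp add: dist_real_def set_integral_diff set_integrable_compact S kt)
    qed
    with d(1) show "\<exists>d>0. \<forall>t. dist t t0 < d \<longrightarrow>
      dist (LINT z:S|lborel. k t z) (LINT z:S|lborel. k t0 z) < e" by blast
  qed
  then show ?thesis by (simp add: continuous_on_eq_continuous_at)
qed

text \<open>By compactness, \<open>k' t\<close> is uniformly close to \<open>k' t\<^sub>0\<close> on \<open>S\<close> for \<open>t\<close> near \<open>t\<^sub>0\<close>. The mean
  value inequality turns this into a bound for the error of the linear approximation of \<open>k\<close> that
  is uniform on \<open>S\<close> and can be integrated.\<close>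

lemma has_real_derivative_set_integral:
  fixes k k' :: "real \<Rightarrow> 'a::euclidean_space \<Rightarrow> real"
  assumes S: "compact S"
    and k: "\<And>t. continuous_on S (k t)"
    and k': "continuous_on UNIV (\<lambda>(t, z). k' t z)"
    and deriv: "\<And>t z. ((\<lambda>t. k t z) has_real_derivative k' t z) (at t)"
  shows "((\<lambda>t. LINT z:S|lborel. k t z) has_real_derivative (LINT z:S|lborel. k' t0 z)) (at t0)"
proof -
  have k't: "continuous_on S (k' t)" for t
    using continuous_on_compose2[OF k' continuous_on_Pair[OF continuous_on_const continuous_on_id],
        of t S] by simp
  have "\<exists>d>0. \<forall>t. norm (t - t0) < d \<longrightarrow>
      norm ((LINT z:S|lborel. k t z) - (LINT z:S|lborel. k t0 z)
        - (LINT z:S|lborel. k' t0 z) * (t - t0)) \<le> e * norm (t - t0)" if e: "e > 0" for e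
  proof -
    define c where "c = e / (measure lborel S + 1)"
    have "measure lborel S + 1 > 0" by (rule add_nonneg_pos) auto
    then have c: "c > 0" "measure lborel S * c \<le> e"
      using e by (auto simp: c_def divide_simps algebra_simps)
    have "continuous_on (UNIV \<times> S) (\<lambda>(t, z). k' t z)"
      using k' by (rule continuous_on_subset) auto
    then obtain X where X: "t0 \<in> X" "open X"
      "\<forall>t\<in>X \<inter> UNIV. \<forall>z\<in>S. dist (case (t, z) of (t, z) \<Rightarrow> k' t z)
        (case (t0, z) of (t, z) \<Rightarrow> k' t z) \<le> c"
      by (rule continuous_on_prod_compactE[OF _ S UNIV_I c(1)])
    from X(1,2) obtain d where d: "d > 0" "ball t0 d \<subseteq> X" by (auto simp: open_contains_ball)
    have "norm ((LINT z:S|lborel. k t z) - (LINT z:S|lborel. k t0 z)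
        - (LINT z:S|lborel. k' t0 z) * (t - t0)) \<le> e * norm (t - t0)" if t: "norm (t - t0) < d" for t
    proof -
      have "\<bar>k t z - k t0 z - k' t0 z * (t - t0)\<bar> \<le> c * \<bar>t - t0\<bar>" if z: "z \<in> S" for z
      proof -
        have "norm ((k t z - k' t0 z * t) - (k t0 z - k' t0 z * t0)) \<le> c * norm (t - t0)"
        proof (rule field_differentiable_bound[where S = "ball t0 d"])
          show "((\<lambda>t. k t z - k' t0 z * t) has_field_derivative k' s z - k' t0 z)
              (at s within ball t0 d)" for s
            by (auto intro!: derivative_eq_intros DERIV_subset[OF deriv])
          show "norm (k' s z - k' t0 z) \<le> c" if "s \<in> ball t0 d" for s
            using that d X(3) z by (auto simp: dist_real_def)
        qed (use t d in \<open>auto simp: dist_real_def\<close>)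
        then show ?thesis by (simp add: algebra_simps)
      qed
      then have "\<bar>LINT z:S|lborel. k t z - k t0 z - k' t0 z * (t - t0)\<bar>
          \<le> measure lborel S * (c * \<bar>t - t0\<bar>)"
        by (intro abs_set_integral_compact_le S continuous_intros k k't)
      also have "\<dots> \<le> e * \<bar>t - t0\<bar>"
        using c(2) by (metis abs_ge_zero mult.assoc mult_right_mono)
      finally show ?thesis
        by (simp add: set_integral_diff set_integrable_compact S k k't continuous_intros)
    qed
    with d(1) show ?thesis by blast
  qed
  then show ?thesis
    unfolding has_field_derivative_def has_derivative_at_alt by (auto intro: bounded_linear_mult_right)
qed

section \<open>Functions of class \<open>C\<^sup>r\<close>\<close>

lemma Cr_on_continuous_map:
  "Cr_on r N U f \<Longrightarrow> continuous_map (subtopology (Euclidean_space N) U) euclideanreal f"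
  by (cases r) auto

lemma Cr_on_Suc_imp_Cr_on: "Cr_on (Suc r) N U f \<Longrightarrow> Cr_on r N U f"
proof (induction r arbitrary: f)
  case (Suc r)
  from Suc.prems have f: "continuous_map (subtopology (Euclidean_space N) U) euclideanreal f"
    by simp
  from Suc.prems have "\<forall>i<N. \<exists>g. (\<forall>x\<in>U. ((\<lambda>t. f (x(i := t))) has_real_derivative g x) (at (x i)))
      \<and> Cr_on (Suc r) N U g"
    by (subst (asm) Cr_on.simps(2)) blast
  with f Suc.IH show ?case by (subst Cr_on.simps(2)) blast
qed simp

lemma Cr_on_const: "Cr_on r N U (\<lambda>x. c)"
proof (induction r arbitrary: c)
  case (Suc r)
  then show ?case by (auto intro!: exI[of _ "\<lambda>x. 0"])
qed simp

lemma continuous_map_Euclidean_space_coordinate: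
  "continuous_map (subtopology (Euclidean_space N) U) euclideanreal (\<lambda>x. x i)"
  unfolding Euclidean_space_def
  by (intro continuous_map_from_subtopology continuous_map_product_projection) auto

lemma Cr_on_coordinate: "Cr_on r N U (\<lambda>x. x i)"
proof (cases r)
  case (Suc s)
  have "((\<lambda>t. (x(j := t)) i) has_real_derivative (if i = j then 1 else 0)) (at (x j))"
    for x :: "nat \<Rightarrow> real" and j by (auto intro!: derivative_eq_intros)
  with Suc show ?thesis
    by (auto simp: continuous_map_Euclidean_space_coordinate Cr_on_const
        intro!: exI[of _ "\<lambda>x. if i = j then 1 else 0" for j])
qed (simp add: continuous_map_Euclidean_space_coordinate)

lemma Cr_on_add:
  "Cr_on r N U f \<Longrightarrow> Cr_on r N U g \<Longrightarrow> Cr_on r N U (\<lambda>x. f x + g x)"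
proof (induction r arbitrary: f g)
  case (Suc r)
  have "\<exists>h. (\<forall>x\<in>U. ((\<lambda>t. f (x(i := t)) + g (x(i := t))) has_real_derivative h x) (at (x i)))
      \<and> Cr_on r N U h" if "i < N" for i
  proof -
    from Suc.prems that obtain f' g' where
      "\<forall>x\<in>U. ((\<lambda>t. f (x(i := t))) has_real_derivative f' x) (at (x i))" "Cr_on r N U f'"
      "\<forall>x\<in>U. ((\<lambda>t. g (x(i := t))) has_real_derivative g' x) (at (x i))" "Cr_on r N U g'"
      by (auto 0 3)
    then show ?thesis
      by (intro exI[of _ "\<lambda>x. f' x + g' x"]) (auto intro!: DERIV_add Suc.IH)
  qed
  with Suc.prems show ?case by (auto intro!: continuous_map_add)
qed (auto intro!: continuous_map_add)

lemma Cr_on_mult: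
  "Cr_on r N U f \<Longrightarrow> Cr_on r N U g \<Longrightarrow> Cr_on r N U (\<lambda>x. f x * g x)"
proof (induction r arbitrary: f g)
  case (Suc r)
  have "\<exists>h. (\<forall>x\<in>U. ((\<lambda>t. f (x(i := t)) * g (x(i := t))) has_real_derivative h x) (at (x i)))
      \<and> Cr_on r N U h" if "i < N" for i
  proof -
    from Suc.prems that obtain f' g' where
      f': "\<forall>x\<in>U. ((\<lambda>t. f (x(i := t))) has_real_derivative f' x) (at (x i))" "Cr_on r N U f'" and
      g': "\<forall>x\<in>U. ((\<lambda>t. g (x(i := t))) has_real_derivative g' x) (at (x i))" "Cr_on r N U g'"
      by (auto 0 3)
    have "((\<lambda>t. f (x(i := t)) * g (x(i := t))) has_real_derivative f' x * g x + g' x * f x)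
        (at (x i))" if "x \<in> U" for x
      using DERIV_mult[OF f'(1)[rule_format, OF that] g'(1)[rule_format, OF that]] by simp
    moreover have "Cr_on r N U (\<lambda>x. f' x * g x + g' x * f x)"
      by (intro Cr_on_add Suc.IH f'(2) g'(2) Suc.prems[THEN Cr_on_Suc_imp_Cr_on])
    ultimately show ?thesis by (intro exI[of _ "\<lambda>x. f' x * g x + g' x * f x"]) blast
  qed
  with Suc.prems show ?case by (auto intro!: continuous_map_real_mult)
qed (auto intro!: continuous_map_real_mult)

lemma Cr_on_diff:
  assumes "Cr_on r N U f" "Cr_on r N U g"
  shows "Cr_on r N U (\<lambda>x. f x - g x)"
  using Cr_on_add[OF assms(1) Cr_on_mult[OF Cr_on_const[of r N U "-1"] assms(2)]] by simp

lemma Cr_on_sum: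
  "finite I \<Longrightarrow> (\<And>i. i \<in> I \<Longrightarrow> Cr_on r N U (f i)) \<Longrightarrow> Cr_on r N U (\<lambda>x. \<Sum>i\<in>I. f i x)"
  by (induction I rule: finite_induct) (auto intro!: Cr_on_const Cr_on_add)

lemma Cr_real_SucD:
  assumes "Cr_real (Suc r) f"
  shows "(f has_real_derivative deriv f x) (at x)" "Cr_real r (deriv f)"
proof -
  have *: "(deriv ^^ j) (deriv f) = (deriv ^^ Suc j) f" for j
    by (simp add: funpow_swap1)
  have "(deriv ^^ 0) f field_differentiable at x"
    using assms unfolding Cr_real_def by blast
  then show "(f has_real_derivative deriv f x) (at x)"
    by (simp add: field_differentiable_derivI)
  show "Cr_real r (deriv f)"
    using assms unfolding Cr_real_def * by auto
qed

lemma Cr_real_continuous_on: "Cr_real r f \<Longrightarrow> continuous_on UNIV f"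
proof (cases r)
  case (Suc s)
  assume "Cr_real r f"
  then show ?thesis
    unfolding Suc by (meson Cr_real_SucD(1) DERIV_isCont continuous_at_imp_continuous_on)
qed (simp add: Cr_real_def)

text \<open>Both \<open>deriv h \<circ> f\<close> and the partial derivatives of \<open>f\<close> are of class \<open>C\<^sup>r\<close> if \<open>h\<close> and \<open>f\<close> are of
  class \<open>C\<^sup>r\<^sup>+\<^sup>1\<close>, so an induction over all \<open>h\<close> reduces the chain rule to \<open>Cr_on_mult\<close>.\<close>

lemma Cr_on_compose_real:
  "Cr_real r h \<Longrightarrow> Cr_on r N U f \<Longrightarrow> Cr_on r N U (\<lambda>x. h (f x))"
proof (induction r arbitrary: h f)
  case (Suc r)
  have "\<exists>g. (\<forall>x\<in>U. ((\<lambda>t. h (f (x(i := t)))) has_real_derivative g x) (at (x i)))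
      \<and> Cr_on r N U g" if "i < N" for i
  proof -
    from Suc.prems(2) that obtain f' where
      f': "\<forall>x\<in>U. ((\<lambda>t. f (x(i := t))) has_real_derivative f' x) (at (x i))" "Cr_on r N U f'"
      by auto
    have "((\<lambda>t. h (f (x(i := t)))) has_real_derivative deriv h (f x) * f' x) (at (x i))"
      if "x \<in> U" for x
    proof (rule DERIV_chain2[where f = h])
      show "(h has_real_derivative deriv h (f x)) (at (f (x(i := x i))))"
        using Cr_real_SucD(1)[OF Suc.prems(1)] by simp
    qed (use f' that in blast)
    moreover have "Cr_on r N U (\<lambda>x. deriv h (f x) * f' x)"
      by (rule Cr_on_mult[OF Suc.IH[OF Cr_real_SucD(2)[OF Suc.prems(1)]
          Cr_on_Suc_imp_Cr_on[OF Suc.prems(2)]] f'(2)])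
    ultimately show ?thesis by (intro exI[of _ "\<lambda>x. deriv h (f x) * f' x"]) blast
  qed
  moreover have "continuous_map (subtopology (Euclidean_space N) U) euclideanreal (\<lambda>x. h (f x))"
    using continuous_map_compose[OF Cr_on_continuous_map[OF Suc.prems(2)], of euclideanreal h]
      Cr_real_continuous_on[OF Suc.prems(1)] by (simp add: o_def)
  ultimately show ?case by simp
next
  case 0
  then show ?case
    using continuous_map_compose[of _ euclideanreal f euclideanreal h] Cr_real_continuous_on[of 0 h]
    by (simp add: o_def)
qed

section \<open>Integrals of a Gaussian against monomials\<close>

definition gauss_monomial :: "real \<Rightarrow> nat \<Rightarrow> nat \<Rightarrow> real \<Rightarrow> real \<Rightarrow> real \<times> real \<Rightarrow> real" where
  "gauss_monomial \<sigma> i j b d z = (fst z - b) ^ i * (snd z - (d - b)) ^ j * gauss \<sigma> b d z"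

definition gauss_moment ::
  "real \<Rightarrow> (real \<times> real) set \<Rightarrow> nat \<Rightarrow> nat \<Rightarrow> real \<Rightarrow> real \<Rightarrow> real" where
  "gauss_moment \<sigma> S i j b d = (LINT z:S|lborel. gauss_monomial \<sigma> i j b d z)"

lemma gauss_moment_0_0: "gauss_moment \<sigma> S 0 0 b d = (LINT z:S|lborel. gauss \<sigma> b d z)"
  by (simp add: gauss_moment_def gauss_monomial_def)

lemma continuous_on_gauss_monomial:
  assumes "\<sigma> > 0" "continuous_on A f" "continuous_on A g" "continuous_on A h"
  shows "continuous_on A (\<lambda>w. gauss_monomial \<sigma> i j (f w) (g w) (h w))"
  unfolding gauss_monomial_def gauss_def case_prod_unfold
  using assms by (intro continuous_intros) auto

text \<open>The Gaussian of \<open>(b, d)\<close> is centred at \<open>(b, d - b)\<close>: moving \<open>b\<close> shifts the centre in both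
  directions and moving \<open>d\<close> only in the second. When an exponent is \<open>0\<close>, the term with the
  truncated exponent \<open>i - 1\<close> or \<open>j - 1\<close> carries the coefficient \<open>0\<close>.\<close>

lemma gauss_monomial_deriv_birth:
  assumes "\<sigma> > 0"
  shows "((\<lambda>b. gauss_monomial \<sigma> i j b d z) has_real_derivative
    real j * gauss_monomial \<sigma> i (j - 1) b d z - real i * gauss_monomial \<sigma> (i - 1) j b d z
    + 1 / \<sigma>\<^sup>2 * (gauss_monomial \<sigma> (i + 1) j b d z - gauss_monomial \<sigma> i (j + 1) b d z)) (at b)"
proof -
  have "((\<lambda>b. gauss \<sigma> b d z) has_real_derivative
      1 / \<sigma>\<^sup>2 * ((fst z - b) - (snd z - (d - b))) * gauss \<sigma> b d z) (at b)"
    unfolding gauss_def case_prod_unfold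
    using assms by (auto intro!: derivative_eq_intros simp: field_simps)
  then show ?thesis
    unfolding gauss_monomial_def
    by (auto intro!: derivative_eq_intros simp: algebra_simps add_divide_distrib diff_divide_distrib)
qed

lemma gauss_monomial_deriv_death:
  assumes "\<sigma> > 0"
  shows "((\<lambda>d. gauss_monomial \<sigma> i j b d z) has_real_derivative
    1 / \<sigma>\<^sup>2 * gauss_monomial \<sigma> i (j + 1) b d z - real j * gauss_monomial \<sigma> i (j - 1) b d z) (at d)"
proof -
  have "((\<lambda>d. gauss \<sigma> b d z) has_real_derivative
      1 / \<sigma>\<^sup>2 * (snd z - (d - b)) * gauss \<sigma> b d z) (at d)"
    unfolding gauss_def case_prod_unfold
    using assms by (auto intro!: derivative_eq_intros simp: field_simps)
  then show ?thesis
    unfolding gauss_monomial_def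
    by (auto intro!: derivative_eq_intros simp: algebra_simps add_divide_distrib diff_divide_distrib)
qed

lemma set_integrable_gauss_monomial:
  assumes "\<sigma> > 0" "compact S"
  shows "set_integrable lborel S (gauss_monomial \<sigma> i j b d)"
  by (intro set_integrable_compact continuous_on_gauss_monomial continuous_intros assms)

lemma gauss_moment_deriv_birth:
  assumes "\<sigma> > 0" "compact S"
  shows "((\<lambda>b. gauss_moment \<sigma> S i j b d) has_real_derivative
    real j * gauss_moment \<sigma> S i (j - 1) b d - real i * gauss_moment \<sigma> S (i - 1) j b d
    + 1 / \<sigma>\<^sup>2 * (gauss_moment \<sigma> S (i + 1) j b d - gauss_moment \<sigma> S i (j + 1) b d)) (at b)"
proof -
  let ?k' = "\<lambda>b z. real j * gauss_monomial \<sigma> i (j - 1) b d z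
    - real i * gauss_monomial \<sigma> (i - 1) j b d z
    + 1 / \<sigma>\<^sup>2 * (gauss_monomial \<sigma> (i + 1) j b d z - gauss_monomial \<sigma> i (j + 1) b d z)"
  have "((\<lambda>b. gauss_moment \<sigma> S i j b d) has_real_derivative (LINT z:S|lborel. ?k' b z)) (at b)"
    unfolding gauss_moment_def
    by (rule has_real_derivative_set_integral)
      (auto simp only: case_prod_unfold intro!: assms gauss_monomial_deriv_birth
        continuous_on_gauss_monomial continuous_intros)
  also have "(LINT z:S|lborel. ?k' b z) =
      real j * gauss_moment \<sigma> S i (j - 1) b d - real i * gauss_moment \<sigma> S (i - 1) j b d
      + 1 / \<sigma>\<^sup>2 * (gauss_moment \<sigma> S (i + 1) j b d - gauss_moment \<sigma> S i (j + 1) b d)"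
    unfolding gauss_moment_def
    by (simp only: set_integral_add set_integral_diff set_integral_mult_right
        set_integrable_mult_right set_integrable_gauss_monomial[OF assms])
  finally show ?thesis .
qed

lemma gauss_moment_deriv_death:
  assumes "\<sigma> > 0" "compact S"
  shows "((\<lambda>d. gauss_moment \<sigma> S i j b d) has_real_derivative
    1 / \<sigma>\<^sup>2 * gauss_moment \<sigma> S i (j + 1) b d - real j * gauss_moment \<sigma> S i (j - 1) b d) (at d)"
proof -
  let ?k' = "\<lambda>d z. 1 / \<sigma>\<^sup>2 * gauss_monomial \<sigma> i (j + 1) b d z
    - real j * gauss_monomial \<sigma> i (j - 1) b d z"
  have "((\<lambda>d. gauss_moment \<sigma> S i j b d) has_real_derivative (LINT z:S|lborel. ?k' d z)) (at d)"
    unfolding gauss_moment_def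
    by (rule has_real_derivative_set_integral)
      (auto simp only: case_prod_unfold intro!: assms gauss_monomial_deriv_death
        continuous_on_gauss_monomial continuous_intros)
  also have "(LINT z:S|lborel. ?k' d z) =
      1 / \<sigma>\<^sup>2 * gauss_moment \<sigma> S i (j + 1) b d - real j * gauss_moment \<sigma> S i (j - 1) b d"
    unfolding gauss_moment_def
    by (simp only: set_integral_diff set_integral_mult_right
        set_integrable_mult_right set_integrable_gauss_monomial[OF assms])
  finally show ?thesis .
qed

lemma continuous_map_gauss_moment:
  assumes "\<sigma> > 0" "compact S"
  shows "continuous_map (subtopology (Euclidean_space N) U) euclideanreal
    (\<lambda>x. gauss_moment \<sigma> S i j (x p) (x q))"
proof -
  have "continuous_on UNIV (\<lambda>w. LINT z:S|lborel. gauss_monomial \<sigma> i j (fst w) (snd w) z)"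
    by (intro continuous_on_set_integral_compact assms)
      (auto simp only: case_prod_unfold intro!: assms continuous_on_gauss_monomial continuous_intros)
  then have 1: "continuous_map (prod_topology euclideanreal euclideanreal) euclideanreal
      (\<lambda>w. gauss_moment \<sigma> S i j (fst w) (snd w))"
    by (simp add: gauss_moment_def)
  have 2: "continuous_map (subtopology (Euclidean_space N) U)
      (prod_topology euclideanreal euclideanreal) (\<lambda>x. (x p, x q))"
    by (intro continuous_map_pairedI continuous_map_Euclidean_space_coordinate)
  show ?thesis
    using continuous_map_compose[OF 2 1] by (simp add: o_def)
qed

text \<open>The derivatives of a moment are combinations of moments with other exponents, so the
  induction has to treat all exponents at once.\<close>

lemma Cr_on_gauss_moment:
  assumes "\<sigma> > 0" "compact S" "p \<noteq> q"
  shows "Cr_on r N U (\<lambda>x. gauss_moment \<sigma> S i j (x p) (x q))"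
proof (induction r arbitrary: i j)
  case 0
  then show ?case by (simp add: continuous_map_gauss_moment assms)
next
  case (Suc r)
  have "\<exists>g. (\<forall>x\<in>U. ((\<lambda>t. gauss_moment \<sigma> S i j ((x(c := t)) p) ((x(c := t)) q))
      has_real_derivative g x) (at (x c))) \<and> Cr_on r N U g" for c
  proof -
    consider "c = p" | "c = q" | "c \<noteq> p" "c \<noteq> q" by blast
    then show ?thesis
    proof cases
      case 1
      let ?g = "\<lambda>x. real j * gauss_moment \<sigma> S i (j - 1) (x p) (x q)
        - real i * gauss_moment \<sigma> S (i - 1) j (x p) (x q)
        + 1 / \<sigma>\<^sup>2 * (gauss_moment \<sigma> S (i + 1) j (x p) (x q) - gauss_moment \<sigma> S i (j + 1) (x p) (x q))"
      have "((\<lambda>t. gauss_moment \<sigma> S i j ((x(c := t)) p) ((x(c := t)) q))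
          has_real_derivative ?g x) (at (x c))" for x
        using gauss_moment_deriv_birth[OF assms(1,2), of i j "x q" "x p"] 1 assms(3) assms(3)[symmetric]
        by (simp only: fun_upd_apply if_True if_False simp_thms refl)
      moreover have "Cr_on r N U ?g"
        by (intro Cr_on_add Cr_on_diff Cr_on_mult Cr_on_const Suc.IH)
      ultimately show ?thesis by (intro exI[of _ ?g]) blast
    next
      case 2
      let ?g = "\<lambda>x. 1 / \<sigma>\<^sup>2 * gauss_moment \<sigma> S i (j + 1) (x p) (x q)
        - real j * gauss_moment \<sigma> S i (j - 1) (x p) (x q)"
      have "((\<lambda>t. gauss_moment \<sigma> S i j ((x(c := t)) p) ((x(c := t)) q))
          has_real_derivative ?g x) (at (x c))" for x
        using gauss_moment_deriv_death[OF assms(1,2), of i j "x p" "x q"] 2 assms(3) assms(3)[symmetric]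
        by (simp only: fun_upd_apply if_True if_False simp_thms refl)
      moreover have "Cr_on r N U ?g"
        by (intro Cr_on_diff Cr_on_mult Cr_on_const Suc.IH)
      ultimately show ?thesis by (intro exI[of _ ?g]) blast
    next
      case 3
      then show ?thesis by (intro exI[of _ "\<lambda>x. 0"]) (auto intro: Cr_on_const)
    qed
  qed
  then show ?case by (simp add: continuous_map_gauss_moment assms)
qed

section \<open>Persistence images of finite families of intervals\<close>

lemma sum_mset_image_count:
  fixes f :: "'a \<Rightarrow> real"
  shows "(\<Sum>q\<in>#D. f q) = (\<Sum>q\<in>set_mset D. real (count D q) * f q)"
proof (induction D)
  case (add a D)
  have "(\<Sum>q\<in>insert a (set_mset D). real (count (add_mset a D) q) * f q)
      = (\<Sum>q\<in>insert a (set_mset D). real (count D q) * f q + (if q = a then f a else 0))"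
    by (intro sum.cong) (auto simp: algebra_simps)
  also have "\<dots> = (\<Sum>q\<in>insert a (set_mset D). real (count D q) * f q) + f a"
    by (simp add: sum.distrib del: sum.insert_if sum.insert)
  also have "(\<Sum>q\<in>insert a (set_mset D). real (count D q) * f q)
      = (\<Sum>q\<in>set_mset D. real (count D q) * f q)"
    by (intro sum.mono_neutral_right) (auto simp: not_in_iff)
  finally show ?case using add by simp
qed simp

text \<open>The copies of diagonal points are infinite in number but carry the value \<open>0\<close>; off the
  diagonal the multiplicities of \<open>barcode_of D\<close> are those of \<open>D\<close>.\<close>

lemma infsum_barcode_of:
  fixes f :: "real \<times> ereal \<Rightarrow> real"
  assumes diag: "\<And>b. f (b, ereal b) = 0"
  shows "(\<Sum>\<^sub>\<infinity>(q, j) \<in> (SIGMA q:UNIV. {j. enat j < barcode_of D q}). f q) = (\<Sum>q\<in>#D. f q)"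
proof -
  have off: "barcode_of D q = enat (count D q)" if "f q \<noteq> 0" for q
    using that diag by (cases q) (auto simp: barcode_of_def diagonal_inf_def)
  have "(\<Sum>\<^sub>\<infinity>(q, j) \<in> (SIGMA q:UNIV. {j. enat j < barcode_of D q}). f q)
      = (\<Sum>\<^sub>\<infinity>(q, j) \<in> (SIGMA q:set_mset D. {..<count D q}). f q)"
  proof (rule infsum_cong_neutral)
    fix w :: "(real \<times> ereal) \<times> nat"
    obtain q j where w: "w = (q, j)" by fastforce
    show "(case w of (q, j) \<Rightarrow> f q) = 0"
      if "w \<in> (SIGMA q:set_mset D. {..<count D q}) - (SIGMA q:UNIV. {j. enat j < barcode_of D q})"
      using that off[of q] by (cases "f q = 0") (auto simp: w)
    show "(case w of (q, j) \<Rightarrow> f q) = 0"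
      if "w \<in> (SIGMA q:UNIV. {j. enat j < barcode_of D q}) - (SIGMA q:set_mset D. {..<count D q})"
      using that off[of q] by (cases "f q = 0"; cases "q \<in># D") (auto simp: w not_in_iff)
  qed simp
  also have "\<dots> = (\<Sum>q\<in>set_mset D. \<Sum>j<count D q. f q)"
    using sum.Sigma[of "set_mset D" "\<lambda>q. {..<count D q}" "\<lambda>q j. f q"]
    by (simp del: sum_constant)
  also have "\<dots> = (\<Sum>q\<in>#D. f q)"
    by (simp add: sum_mset_image_count)
  finally show ?thesis .
qed

lemma persistence_surface_Q0:
  assumes "\<omega> 0 = 0"
  shows "persistence_surface \<omega> \<sigma> (Q0 m x) z =
    (\<Sum>i<m. \<omega> (x (2 * i + 1) - x (2 * i)) * gauss \<sigma> (x (2 * i)) (x (2 * i + 1)) z)"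
proof -
  let ?f = "\<lambda>(b, d). \<omega> (real_of_ereal d - b) * gauss \<sigma> b (real_of_ereal d) z"
  have "persistence_surface \<omega> \<sigma> (Q0 m x) z
      = (\<Sum>\<^sub>\<infinity>(q, j) \<in> (SIGMA q:UNIV. {j. enat j < Q0 m x q}). ?f q)"
    by (simp add: persistence_surface_def case_prod_unfold)
  also have "\<dots> = (\<Sum>q\<in>#{# (x (2 * i), ereal (x (2 * i + 1))). i \<in># mset_set {..<m} #}. ?f q)"
    unfolding Q0_def by (rule infsum_barcode_of) (simp add: assms)
  finally show ?thesis
    by (simp add: sum_unfold_sum_mset image_mset.compositionality o_def)
qed

lemma compact_subsquare: "compact (subsquare p u v n k l)"
proof -
  have "subsquare p u v n k l = (\<lambda>(s, t). p + s *\<^sub>R u + t *\<^sub>R v) `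
      ({(real k - 1) / real n .. real k / real n} \<times> {(real l - 1) / real n .. real l / real n})"
    unfolding subsquare_def image_def
    by (rule Collect_cong)
      (simp only: Bex_def mem_Times_iff split_paired_Ex
        case_prod_conv fst_conv snd_conv; blast)
  also have "compact \<dots>"
    unfolding case_prod_unfold
    by (intro compact_continuous_image compact_Times compact_Icc continuous_intros)
  finally show ?thesis .
qed

lemma persistence_image_Q0:
  assumes "\<omega> 0 = 0" "\<sigma> > 0" "c < n\<^sup>2"
  shows "persistence_image \<omega> \<sigma> p u v n (Q0 m x) c =
    (\<Sum>i<m. \<omega> (x (2 * i + 1) - x (2 * i)) *
      gauss_moment \<sigma> (subsquare p u v n (c div n + 1) (c mod n + 1)) 0 0 (x (2 * i)) (x (2 * i + 1)))"
proof -
  let ?S = "subsquare p u v n (c div n + 1) (c mod n + 1)"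
  let ?w = "\<lambda>i. \<omega> (x (2 * i + 1) - x (2 * i))"
  let ?g = "\<lambda>i. gauss \<sigma> (x (2 * i)) (x (2 * i + 1))"
  have "set_integrable lborel ?S (gauss \<sigma> b d)" for b d
    using set_integrable_gauss_monomial[OF assms(2) compact_subsquare,
        of p u v n "c div n + 1" "c mod n + 1" 0 0 b d]
    by (simp add: gauss_monomial_def[abs_def])
  then have "set_integrable lborel ?S (\<lambda>z. ?w i * ?g i z)" for i
    by (rule set_integrable_mult_right)
  then have "(LINT z:?S|lborel. \<Sum>i<m. ?w i * ?g i z) = (\<Sum>i<m. LINT z:?S|lborel. ?w i * ?g i z)"
    unfolding set_lebesgue_integral_def set_integrable_def scaleR_sum_right
    by (rule Bochner_Integration.integral_sum)
  then show ?thesis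
    using assms(3)
    by (simp add: persistence_image_def persistence_surface_Q0[of \<omega>, OF assms(1), abs_def]
        gauss_moment_0_0)
qed

theorem proposition7p3:
  fixes r n :: nat and \<omega> :: "real \<Rightarrow> real" and \<sigma> :: real
    and B :: "(real \<times> real) set" and p u v :: "real \<times> real"
  assumes "\<omega> 0 = 0"
    and "\<sigma> > 0"
    and "is_square B p u v"
    and "Cr_real r \<omega>"
  shows "\<forall>D \<in> Bar0. r_differentiable_at r (n\<^sup>2) (persistence_image \<omega> \<sigma> p u v n) D"
proof
  fix D assume "D \<in> Bar0"
  have "Cr_on r (2 * m) U (\<lambda>x. persistence_image \<omega> \<sigma> p u v n (Q0 m x) c)" if "c < n\<^sup>2" for m U c
    unfolding persistence_image_Q0[of \<omega>, OF assms(1,2) that]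
    by (intro Cr_on_sum Cr_on_mult Cr_on_compose_real[OF assms(4)] Cr_on_diff Cr_on_coordinate
        Cr_on_gauss_moment assms(2) compact_subsquare) auto
  then have "Cr_map_on r (2 * m) (n\<^sup>2) U (persistence_image \<omega> \<sigma> p u v n \<circ> Q0 m)" for m U
    by (auto simp: Cr_map_on_def topspace_Euclidean_space persistence_image_def)
  \<comment> \<open>Every lift has the whole space as a suitable neighborhood.\<close>
  then show "r_differentiable_at r (n\<^sup>2) (persistence_image \<omega> \<sigma> p u v n) D"
    unfolding r_differentiable_at_def by (meson openin_topspace)
qed

end
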